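(* Let $n\in\mathbb{N}$, let $S_1,\ldots,S_n$ be pairwise disjoint finite semigroups, let $S$ be their zero-union, and let $\mathit{NC}=\{i\in\{1,\ldots,n\} : S_i \text{ is not commutative}\}$. Suppose that $|\mathit{NC}|\geqslant 2$. Then $\mathcal{G}(S)$ contains cycles. Moreover: (1) If $|\mathit{NC}|\geqslant 3$ or there exists $i\in\mathit{NC}$ such that $\mathcal{G}(S_i)$ is not a null graph, then $\mathrm{girth}(\mathcal{G}(S))=3$. (2) If $|\mathit{NC}|=2$ and $\mathcal{G}(S_i)$ is a null graph for all $i\in\mathit{NC}$, then $\mathrm{girth}(\mathcal{G}(S))=4$.
   Context: Zero-union: for pairwise disjoint semigroups $S_1,\ldots,S_n$, their zero-union is the set $\{0\}\cup\bigcup_{i=1}^n S_i$, where $0$ is a new element, and where the product of $x$ and $y$ is the element $xy\in S_i$ if $x,y\in S_i$ for some $i$, and is $0$ in all remaining cases. The center of a semigroup $T$ is $Z(T)=\{x\in T: xy=yx \text{ for all } y\in T\}$. For a finite non-commutative semigroup $T$, the commuting graph $\mathcal{G}(T)$ is the simple graph with vertex set $T\setminus Z(T)$ in which two distinct vertices $x,y$ are adjacent if and only if $xy=yx$. A null graph is a simple graph with no edges. The girth of a graph containing cycles is the length of a shortest cycle. *)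

theory Defs
  imports
    "HOL-Algebra.Congruence"
    "HOL-Library.Disjoint_Sets"
    "HOL-Library.Extended_Nat"
    "Graph_Theory.Graph_Theory"
begin

section \<open>Semigroups on a carrier set\<close>

text \<open>The library's locale \<^locale>\<open>semigroup\<close> concerns an operation on a whole type; several
  pairwise disjoint semigroups inside one type need explicit carriers.\<close>

record 'a semigrp = "'a partial_object" +
  sg_mult :: "'a \<Rightarrow> 'a \<Rightarrow> 'a" (infixl \<open>\<cdot>\<index>\<close> 70)

locale semigrp =
  fixes T :: "'a semigrp" (structure)
  assumes closed: "\<lbrakk>x \<in> carrier T; y \<in> carrier T\<rbrakk> \<Longrightarrow> x \<cdot> y \<in> carrier T"
    and assoc: "\<lbrakk>x \<in> carrier T; y \<in> carrier T; z \<in> carrier T\<rbrakk> \<Longrightarrow> (x \<cdot> y) \<cdot> z = x \<cdot> (y \<cdot> z)"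

definition commutative :: "'a semigrp \<Rightarrow> bool" where
  "commutative T \<longleftrightarrow> (\<forall>x\<in>carrier T. \<forall>y\<in>carrier T. x \<cdot>\<^bsub>T\<^esub> y = y \<cdot>\<^bsub>T\<^esub> x)"

definition center :: "'a semigrp \<Rightarrow> 'a set" where
  "center T = {x \<in> carrier T. \<forall>y\<in>carrier T. x \<cdot>\<^bsub>T\<^esub> y = y \<cdot>\<^bsub>T\<^esub> x}"

text \<open>The new zero element is \<^term>\<open>None\<close>, and \<^term>\<open>Some\<close> embeds the given semigroups. For pairwise
  disjoint carriers the index selected by the definite description is unique.\<close>

definition zero_union :: "'i set \<Rightarrow> ('i \<Rightarrow> 'a semigrp) \<Rightarrow> 'a option semigrp" where
  "zero_union I S =
    \<lparr> carrier = insert None (Some ` (\<Union>i\<in>I. carrier (S i))),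
      sg_mult = (\<lambda>x y. case (x, y) of
          (Some a, Some b) \<Rightarrow>
            (if \<exists>i\<in>I. a \<in> carrier (S i) \<and> b \<in> carrier (S i)
             then Some (a \<cdot>\<^bsub>S (THE i. i \<in> I \<and> a \<in> carrier (S i) \<and> b \<in> carrier (S i))\<^esub> b)
             else None)
        | _ \<Rightarrow> None) \<rparr>"

section \<open>Commuting graphs, cycles and girth\<close>

text \<open>A simple graph is represented, as in the library, by its symmetric loop-free digraph
  (locale \<^locale>\<open>pair_graph\<close>): an edge between x and y is the pair of arcs (x, y) and (y, x).\<close>

definition commuting_graph :: "'a semigrp \<Rightarrow> 'a pair_pre_digraph" where
  "commuting_graph T =
    \<lparr> pverts = carrier T - center T,
      parcs = {(x, y). x \<in> carrier T - center T \<and> y \<in> carrier T - center T \<and>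
                       x \<noteq> y \<and> x \<cdot>\<^bsub>T\<^esub> y = y \<cdot>\<^bsub>T\<^esub> x} \<rparr>"

definition null_graph :: "'a pair_pre_digraph \<Rightarrow> bool" where
  "null_graph G \<longleftrightarrow> parcs G = {}"

text \<open>A cycle of the library is a nonempty closed walk (a list of arcs) without repeated vertices
  apart from its endpoints. In a symmetric loop-free digraph this includes going back and forth
  along one edge; requiring length at least 3 leaves exactly the cycles of the undirected graph.\<close>

definition graph_cycle :: "'a pair_pre_digraph \<Rightarrow> ('a \<times> 'a) list \<Rightarrow> bool" where
  "graph_cycle G p \<longleftrightarrow> pre_digraph.cycle (with_proj G) p \<and> 3 \<le> length p"

text \<open>This infimum is \<^term>\<open>\<infinity>\<close> for a graph without cycles.\<close>

definition girth :: "'a pair_pre_digraph \<Rightarrow> enat" where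
  "girth G = (INF p\<in>{p. graph_cycle G p}. enat (length p))"

section \<open>Well-definedness\<close>

lemma pair_graph_commuting_graph:
  assumes "finite (carrier T)"
  shows "pair_graph (commuting_graph T)"
proof
  show "finite (parcs (commuting_graph T))"
    by (rule finite_subset[of _ "carrier T \<times> carrier T"])
      (use assms in \<open>auto simp: commuting_graph_def\<close>)
qed (use assms in \<open>auto simp: commuting_graph_def symmetric_def sym_def arcs_ends_conv\<close>)

lemma zero_union_mult_same:
  assumes "disjoint_family_on (\<lambda>i. carrier (S i)) I"
    and "i \<in> I" "a \<in> carrier (S i)" "b \<in> carrier (S i)"
  shows "Some a \<cdot>\<^bsub>zero_union I S\<^esub> Some b = Some (a \<cdot>\<^bsub>S i\<^esub> b)"
proof -
  have "(THE i. i \<in> I \<and> a \<in> carrier (S i) \<and> b \<in> carrier (S i)) = i"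
    using assms by (intro the_equality) (auto simp: disjoint_family_on_def)
  then show ?thesis
    using assms(2-4) by (auto simp: zero_union_def)
qed

lemma zero_union_mult_different:
  assumes "disjoint_family_on (\<lambda>i. carrier (S i)) I"
    and "i \<in> I" "j \<in> I" "i \<noteq> j" "a \<in> carrier (S i)" "b \<in> carrier (S j)"
  shows "Some a \<cdot>\<^bsub>zero_union I S\<^esub> Some b = None"
proof -
  have "\<not> (\<exists>k\<in>I. a \<in> carrier (S k) \<and> b \<in> carrier (S k))"
  proof
    assume "\<exists>k\<in>I. a \<in> carrier (S k) \<and> b \<in> carrier (S k)"
    then obtain k where "k \<in> I" "a \<in> carrier (S k)" "b \<in> carrier (S k)" by blast
    then have "k = i" "k = j"
      using assms unfolding disjoint_family_on_def by blast+
    with assms(4) show False by simp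
  qed
  then show ?thesis
    by (simp add: zero_union_def)
qed

lemma zero_union_mult_zero:
  "None \<cdot>\<^bsub>zero_union I S\<^esub> y = None" "x \<cdot>\<^bsub>zero_union I S\<^esub> None = None"
  by (auto simp: zero_union_def split: option.splits)

lemma semigrp_zero_union:
  assumes disj: "disjoint_family_on (\<lambda>i. carrier (S i)) I"
    and sg: "\<And>i. i \<in> I \<Longrightarrow> semigrp (S i)"
  shows "semigrp (zero_union I S)"
proof -
  let ?Z = "zero_union I S"
  have car: "x \<in> carrier ?Z \<longleftrightarrow> x = None \<or> (\<exists>i\<in>I. \<exists>a\<in>carrier (S i). x = Some a)" for x
    by (auto simp: zero_union_def)
  note same = zero_union_mult_same[OF disj] and diff = zero_union_mult_different[OF disj]
    and zero = zero_union_mult_zero[of I S]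
  note cl = semigrp.closed[OF sg] and as = semigrp.assoc[OF sg]
  have pr: "Some a \<cdot>\<^bsub>?Z\<^esub> Some b = (if i = j then Some (a \<cdot>\<^bsub>S i\<^esub> b) else None)"
    if "i \<in> I" "j \<in> I" "a \<in> carrier (S i)" "b \<in> carrier (S j)" for i j a b
    using that same diff by auto
  show ?thesis
  proof
    fix x y assume "x \<in> carrier ?Z" "y \<in> carrier ?Z"
    then show "x \<cdot>\<^bsub>?Z\<^esub> y \<in> carrier ?Z"
      unfolding car using cl by (elim disjE bexE) (auto simp: zero pr)
  next
    fix x y z assume "x \<in> carrier ?Z" "y \<in> carrier ?Z" "z \<in> carrier ?Z"
    then show "x \<cdot>\<^bsub>?Z\<^esub> y \<cdot>\<^bsub>?Z\<^esub> z = x \<cdot>\<^bsub>?Z\<^esub> (y \<cdot>\<^bsub>?Z\<^esub> z)"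
      unfolding car using cl as by (elim disjE bexE) (auto simp: zero pr)
  qed
qed

end

theory Submission
  imports Defs
begin

text \<open>Elements of different components of a zero-union multiply to zero in either order, so they
  commute. Hence an element of \<open>S i\<close> is central in the zero-union exactly if it is central
  in \<open>S i\<close>, and the zero itself is central. The commuting graph of the zero-union is therefore the
  join of the commuting graphs of the components: their disjoint union together with all edges
  between different components (\<open>pverts_commuting_graph_zero_union\<close> and
  \<open>parcs_commuting_graph_zero_union\<close>). Commutative components contribute no vertices, while a
  non-commutative one contributes at least two, namely any two elements that do not commute.

  Everything else is about joins of graphs. With two nonempty parts, two vertices from each
  part, taken alternately, form a 4-cycle (\<open>zero_union_quadrangle\<close>). A triangle arises from three
  nonempty parts, or from an edge inside one part and a vertex of another. If there are just two
  parts and neither contains an edge, then the join is bipartite: two of the three vertices of a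
  triangle would lie in the same part (\<open>zero_union_null_triangle\<close>), so the girth is 4.\<close>

section \<open>Short cycles and girth\<close>

lemma graph_cycle_triangle:
  assumes "x \<in> pverts G" "x \<noteq> y" "y \<noteq> z" "z \<noteq> x"
    and "(x, y) \<in> parcs G" "(y, z) \<in> parcs G" "(z, x) \<in> parcs G"
  shows "graph_cycle G [(x, y), (y, z), (z, x)]"
  using assms by (auto simp: graph_cycle_def pre_digraph.cycle_def pre_digraph.awalk_def
      pre_digraph.cas.simps pre_digraph.awalk_verts.simps)

lemma graph_cycle_quadrangle:
  assumes "x \<in> pverts G" "distinct [x, y, z, w]"
    and "(x, y) \<in> parcs G" "(y, z) \<in> parcs G" "(z, w) \<in> parcs G" "(w, x) \<in> parcs G"
  shows "graph_cycle G [(x, y), (y, z), (z, w), (w, x)]"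
  using assms by (auto simp: graph_cycle_def pre_digraph.cycle_def pre_digraph.awalk_def
      pre_digraph.cas.simps pre_digraph.awalk_verts.simps)

lemma graph_cycle_length_3E:
  assumes "graph_cycle G p" "length p = 3"
  obtains x y z where "(x, y) \<in> parcs G" "(y, z) \<in> parcs G" "(z, x) \<in> parcs G"
proof -
  obtain a b c where "p = [a, b, c]"
    using assms(2) by (auto simp: numeral_3_eq_3 length_Suc_conv)
  with assms(1) that show ?thesis
    by (cases a; cases b; cases c)
      (auto simp: graph_cycle_def pre_digraph.cycle_def pre_digraph.awalk_def
        pre_digraph.cas.simps pre_digraph.awalk_verts.simps)
qed

lemma girth_eqI:
  assumes "graph_cycle G p" "length p = k"
    and "\<And>q. graph_cycle G q \<Longrightarrow> k \<le> length q"
  shows "girth G = enat k"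
  unfolding girth_def
proof (rule antisym)
  show "(INF p\<in>{p. graph_cycle G p}. enat (length p)) \<le> enat k"
    using assms(1,2) by (intro INF_lower2[of p]) auto
  show "enat k \<le> (INF p\<in>{p. graph_cycle G p}. enat (length p))"
    using assms(3) by (intro INF_greatest) auto
qed

lemma girth_eq_3I:
  assumes "graph_cycle G p" "length p = 3"
  shows "girth G = 3"
  using girth_eqI[OF assms] by (simp add: graph_cycle_def numeral_eq_enat)

text \<open>A cycle has length at least 3 by definition, so only triangles have to be excluded.\<close>

lemma girth_eq_4I:
  assumes "graph_cycle G p" "length p = 4"
    and no_triangle: "\<And>x y z. \<lbrakk>(x, y) \<in> parcs G; (y, z) \<in> parcs G; (z, x) \<in> parcs G\<rbrakk> \<Longrightarrow> False"
  shows "girth G = 4"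
proof -
  have "4 \<le> length q" if "graph_cycle G q" for q
  proof -
    have "length q \<noteq> 3"
      using that no_triangle by (metis graph_cycle_length_3E)
    moreover have "3 \<le> length q"
      using that by (simp add: graph_cycle_def)
    ultimately show ?thesis
      by simp
  qed
  from girth_eqI[OF assms(1,2) this] show ?thesis
    by (simp add: numeral_eq_enat)
qed

section \<open>The commuting graph of a zero-union\<close>

lemma not_commutative_vertices:
  assumes "\<not> commutative T"
  obtains x y where "x \<in> pverts (commuting_graph T)" "y \<in> pverts (commuting_graph T)" "x \<noteq> y"
proof -
  obtain x y where "x \<in> carrier T" "y \<in> carrier T" "x \<cdot>\<^bsub>T\<^esub> y \<noteq> y \<cdot>\<^bsub>T\<^esub> x"
    using assms by (auto simp: commutative_def)
  then show ?thesis
    by (intro that[of x y]) (force simp: commuting_graph_def center_def)+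
qed

lemma commutative_no_vertices:
  "commutative T \<Longrightarrow> pverts (commuting_graph T) = {}"
  by (auto simp: commutative_def commuting_graph_def center_def)

lemma parcs_subset_pverts:
  "(x, y) \<in> parcs (commuting_graph T) \<Longrightarrow>
    x \<in> pverts (commuting_graph T) \<and> y \<in> pverts (commuting_graph T) \<and> x \<noteq> y"
  by (simp add: commuting_graph_def)

lemma commute_zero_union_iff:
  assumes "disjoint_family_on (\<lambda>i. carrier (S i)) I"
    and "i \<in> I" "j \<in> I" "a \<in> carrier (S i)" "b \<in> carrier (S j)"
  shows "Some a \<cdot>\<^bsub>zero_union I S\<^esub> Some b = Some b \<cdot>\<^bsub>zero_union I S\<^esub> Some a \<longleftrightarrow>
    i \<noteq> j \<or> a \<cdot>\<^bsub>S i\<^esub> b = b \<cdot>\<^bsub>S i\<^esub> a"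
  using assms zero_union_mult_same[OF assms(1)] zero_union_mult_different[OF assms(1)]
  by (cases "i = j") auto

lemma carrier_zero_union:
  "carrier (zero_union I S) = insert None (Some ` (\<Union>i\<in>I. carrier (S i)))"
  by (simp add: zero_union_def)

text \<open>Passing to the zero-union tests an element against additional ones only in other components,
  and against zero; it commutes with all of these.\<close>

lemma Some_in_center_zero_union_iff:
  assumes "disjoint_family_on (\<lambda>i. carrier (S i)) I" "i \<in> I" "a \<in> carrier (S i)"
  shows "Some a \<in> center (zero_union I S) \<longleftrightarrow> a \<in> center (S i)"
  using assms
  by (auto simp: center_def carrier_zero_union zero_union_mult_zero
      commute_zero_union_iff[OF assms(1)])

lemma pverts_commuting_graph_zero_union:
  assumes "disjoint_family_on (\<lambda>i. carrier (S i)) I"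
  shows "pverts (commuting_graph (zero_union I S)) =
    Some ` (\<Union>i\<in>I. pverts (commuting_graph (S i)))"
proof -
  have "None \<in> center (zero_union I S)"
    by (auto simp: center_def carrier_zero_union zero_union_mult_zero)
  then show ?thesis
    by (auto simp: commuting_graph_def carrier_zero_union Some_in_center_zero_union_iff[OF assms]
        intro!: imageI)
qed

text \<open>For \<open>i \<noteq> j\<close> disjointness of the carriers is used twice: it makes both products zero, and it
  ensures that the two vertices are distinct, as adjacency requires.\<close>

lemma parcs_commuting_graph_zero_union:
  assumes disj: "disjoint_family_on (\<lambda>i. carrier (S i)) I"
    and ij: "i \<in> I" "j \<in> I"
    and ab: "a \<in> pverts (commuting_graph (S i))" "b \<in> pverts (commuting_graph (S j))"
  shows "(Some a, Some b) \<in> parcs (commuting_graph (zero_union I S)) \<longleftrightarrow>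
    i \<noteq> j \<or> (a, b) \<in> parcs (commuting_graph (S i))"
proof -
  have "Some a \<in> pverts (commuting_graph (zero_union I S))"
    "Some b \<in> pverts (commuting_graph (zero_union I S))"
    using ij ab by (auto simp: pverts_commuting_graph_zero_union[OF disj])
  moreover have car: "a \<in> carrier (S i)" "b \<in> carrier (S j)"
    using ab by (auto simp: commuting_graph_def)
  moreover have "a \<noteq> b" if "i \<noteq> j"
    using disj ij car that by (auto simp: disjoint_family_on_def)
  ultimately show ?thesis
    using ab commute_zero_union_iff[OF disj ij car] by (auto simp: commuting_graph_def)
qed

section \<open>Cycles in the commuting graph of a zero-union\<close>

text \<open>Two non-commuting elements from each of two components, taken alternately, form a 4-cycle:
  consecutive ones lie in different components.\<close>

lemma zero_union_quadrangle:
  assumes disj: "disjoint_family_on (\<lambda>i. carrier (S i)) I"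
    and ij: "i \<in> I" "j \<in> I" "i \<noteq> j" "\<not> commutative (S i)" "\<not> commutative (S j)"
  obtains p where "graph_cycle (commuting_graph (zero_union I S)) p" "length p = 4"
proof -
  let ?G = "commuting_graph (zero_union I S)"
  note arcs = parcs_commuting_graph_zero_union[OF disj]
  obtain a b where ab: "a \<in> pverts (commuting_graph (S i))" "b \<in> pverts (commuting_graph (S i))"
    "a \<noteq> b"
    by (rule not_commutative_vertices[OF ij(4)])
  obtain c d where cd: "c \<in> pverts (commuting_graph (S j))" "d \<in> pverts (commuting_graph (S j))"
    "c \<noteq> d"
    by (rule not_commutative_vertices[OF ij(5)])
  have e: "(Some a, Some c) \<in> parcs ?G" "(Some c, Some b) \<in> parcs ?G"
    "(Some b, Some d) \<in> parcs ?G" "(Some d, Some a) \<in> parcs ?G"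
    using ij ab cd arcs[of i j a c] arcs[of j i c b] arcs[of i j b d] arcs[of j i d a] by auto
  have "graph_cycle ?G [(Some a, Some c), (Some c, Some b), (Some b, Some d), (Some d, Some a)]"
    using e e[THEN parcs_subset_pverts] ab(3) cd(3) by (intro graph_cycle_quadrangle) auto
  then show ?thesis
    by (rule that) simp
qed

lemma girth_commuting_graph_triangle:
  assumes "(x, y) \<in> parcs (commuting_graph T)" "(y, z) \<in> parcs (commuting_graph T)"
    "(z, x) \<in> parcs (commuting_graph T)"
  shows "girth (commuting_graph T) = 3"
  using assms assms[THEN parcs_subset_pverts]
  by (intro girth_eq_3I[OF graph_cycle_triangle[of x _ y z]]) auto

lemma girth_zero_union_three_noncommutative:
  assumes disj: "disjoint_family_on (\<lambda>i. carrier (S i)) I"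
    and ijk: "i \<in> I" "j \<in> I" "k \<in> I" "i \<noteq> j" "j \<noteq> k" "k \<noteq> i"
    and nc: "\<not> commutative (S i)" "\<not> commutative (S j)" "\<not> commutative (S k)"
  shows "girth (commuting_graph (zero_union I S)) = 3"
proof -
  note arcs = parcs_commuting_graph_zero_union[OF disj]
  obtain a where a: "a \<in> pverts (commuting_graph (S i))"
    by (rule not_commutative_vertices[OF nc(1)])
  obtain b where b: "b \<in> pverts (commuting_graph (S j))"
    by (rule not_commutative_vertices[OF nc(2)])
  obtain c where c: "c \<in> pverts (commuting_graph (S k))"
    by (rule not_commutative_vertices[OF nc(3)])
  show ?thesis
    using ijk a b c arcs[of i j a b] arcs[of j k b c] arcs[of k i c a]
    by (intro girth_commuting_graph_triangle[of "Some a" "Some b" _ "Some c"]) auto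
qed

lemma girth_zero_union_not_null:
  assumes disj: "disjoint_family_on (\<lambda>i. carrier (S i)) I"
    and ij: "i \<in> I" "j \<in> I" "i \<noteq> j"
    and "\<not> null_graph (commuting_graph (S i))" and nc: "\<not> commutative (S j)"
  shows "girth (commuting_graph (zero_union I S)) = 3"
proof -
  note arcs = parcs_commuting_graph_zero_union[OF disj]
  obtain a b where ab: "(a, b) \<in> parcs (commuting_graph (S i))"
    using assms(5) by (auto simp: null_graph_def)
  obtain c where c: "c \<in> pverts (commuting_graph (S j))"
    by (rule not_commutative_vertices[OF nc])
  show ?thesis
    using ij c ab parcs_subset_pverts[OF ab] arcs[of i i a b] arcs[of i j b c] arcs[of j i c a]
    by (intro girth_commuting_graph_triangle[of "Some a" "Some b" _ "Some c"]) auto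
qed

text \<open>If no component contains an edge, then the corners of a triangle lie in three different
  components, each of which is non-commutative because it contributes a vertex.\<close>

lemma zero_union_null_triangle:
  assumes disj: "disjoint_family_on (\<lambda>i. carrier (S i)) I"
    and null: "\<And>i. i \<in> I \<Longrightarrow> \<not> commutative (S i) \<Longrightarrow> null_graph (commuting_graph (S i))"
    and e: "(x, y) \<in> parcs (commuting_graph (zero_union I S))"
      "(y, z) \<in> parcs (commuting_graph (zero_union I S))"
      "(z, x) \<in> parcs (commuting_graph (zero_union I S))"
  obtains i j k where "{i, j, k} \<subseteq> {i \<in> I. \<not> commutative (S i)}" "card {i, j, k} = 3"
proof -
  let ?G = "commuting_graph (zero_union I S)"
  note arcs = parcs_commuting_graph_zero_union[OF disj]
  have vertex: "\<exists>i a. i \<in> I \<and> \<not> commutative (S i) \<and> a \<in> pverts (commuting_graph (S i)) \<and> v = Some a"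
    if "v \<in> pverts ?G" for v
    using that commutative_no_vertices unfolding pverts_commuting_graph_zero_union[OF disj]
    by blast
  obtain i a where i: "i \<in> I" "\<not> commutative (S i)" "a \<in> pverts (commuting_graph (S i))"
    "x = Some a"
    using vertex[of x] parcs_subset_pverts[OF e(1)] by blast
  obtain j b where j: "j \<in> I" "\<not> commutative (S j)" "b \<in> pverts (commuting_graph (S j))"
    "y = Some b"
    using vertex[of y] parcs_subset_pverts[OF e(2)] by blast
  obtain k c where k: "k \<in> I" "\<not> commutative (S k)" "c \<in> pverts (commuting_graph (S k))"
    "z = Some c"
    using vertex[of z] parcs_subset_pverts[OF e(3)] by blast
  have "i \<noteq> j" "j \<noteq> k" "k \<noteq> i"
    using e i j k null[unfolded null_graph_def]
      arcs[of i j a b] arcs[of j k b c] arcs[of k i c a] by auto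
  then have "card {i, j, k} = 3"
    by simp
  with i j k show ?thesis
    by (intro that[of i j k]) auto
qed

theorem theorem3p7:
  fixes n :: nat
    and S :: "nat \<Rightarrow> 'a semigrp"
    and Z :: "'a option semigrp"
    and NC :: "nat set"
  assumes "\<And>i. i \<in> {1..n} \<Longrightarrow> semigrp (S i)"
    and "\<And>i. i \<in> {1..n} \<Longrightarrow> finite (carrier (S i))"
    and "disjoint_family_on (\<lambda>i. carrier (S i)) {1..n}"
    and "Z = zero_union {1..n} S"
    and "NC = {i \<in> {1..n}. \<not> commutative (S i)}"
    and "card NC \<ge> 2"
  shows "(\<exists>p. graph_cycle (commuting_graph Z) p) \<and>
    (card NC \<ge> 3 \<or> (\<exists>i\<in>NC. \<not> null_graph (commuting_graph (S i))) \<longrightarrow>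
      girth (commuting_graph Z) = 3) \<and>
    (card NC = 2 \<and> (\<forall>i\<in>NC. null_graph (commuting_graph (S i))) \<longrightarrow>
      girth (commuting_graph Z) = 4)"
proof -
  note disj = assms(3)
  have NC: "i \<in> {1..n}" "\<not> commutative (S i)" if "i \<in> NC" for i
    using that assms(5) by simp_all
  have other: "\<exists>j\<in>NC. j \<noteq> i" for i
  proof -
    have "\<not> NC \<subseteq> {i}"
      using assms(6) by (auto dest!: subset_singletonD)
    then show ?thesis
      by blast
  qed
  then obtain i j where ij: "i \<in> NC" "j \<in> NC" "i \<noteq> j"
    by metis
  obtain p where p: "graph_cycle (commuting_graph Z) p" "length p = 4"
    unfolding assms(4)
    by (rule zero_union_quadrangle[OF disj NC(1)[OF ij(1)] NC(1)[OF ij(2)] ij(3)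
          NC(2)[OF ij(1)] NC(2)[OF ij(2)]])

  have three: "girth (commuting_graph Z) = 3" if "card NC \<ge> 3"
  proof -
    obtain T where T: "T \<subseteq> NC" "card T = 3"
      by (rule obtain_subset_with_card_n[OF \<open>card NC \<ge> 3\<close>])
    from T(2) obtain i j k where "T = {i, j, k}" and ne: "i \<noteq> j" "j \<noteq> k" "k \<noteq> i"
      by (metis card_3_iff)
    with T(1) have "i \<in> NC" "j \<in> NC" "k \<in> NC"
      by simp_all
    then show ?thesis
      unfolding assms(4) by (intro girth_zero_union_three_noncommutative[OF disj _ _ _ ne] NC)
  qed
  have edge: "girth (commuting_graph Z) = 3"
    if "i \<in> NC" "\<not> null_graph (commuting_graph (S i))" for i
  proof -
    from other[of i] obtain j where "j \<in> NC" "i \<noteq> j"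
      by blast
    with that show ?thesis
      unfolding assms(4) by (intro girth_zero_union_not_null[OF disj, of i j] NC)
  qed
  have null: "girth (commuting_graph Z) = 4"
    if two: "card NC = 2" and null: "\<And>i. i \<in> NC \<Longrightarrow> null_graph (commuting_graph (S i))"
  proof (rule girth_eq_4I[OF p])
    fix x y z
    assume e: "(x, y) \<in> parcs (commuting_graph Z)" "(y, z) \<in> parcs (commuting_graph Z)"
      "(z, x) \<in> parcs (commuting_graph Z)"
    have "null_graph (commuting_graph (S i))" if "i \<in> {1..n}" "\<not> commutative (S i)" for i
      using that assms(5) by (intro null) simp
    then obtain i j k where "{i, j, k} \<subseteq> NC" "card {i, j, k} = 3"
      unfolding assms(5) by (rule zero_union_null_triangle[OF disj _ e[unfolded assms(4)]])
    moreover have "finite NC"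
      using assms(5) by simp
    ultimately have "3 \<le> card NC"
      by (metis card_mono)
    with two show False
      by simp
  qed
  show ?thesis
  proof (intro conjI impI)
    show "\<exists>p. graph_cycle (commuting_graph Z) p"
      using p(1) by (rule exI)
    show "girth (commuting_graph Z) = 3"
      if "card NC \<ge> 3 \<or> (\<exists>i\<in>NC. \<not> null_graph (commuting_graph (S i)))"
      using that by (elim disjE bexE) (rule three edge; assumption)+
    show "girth (commuting_graph Z) = 4"
      if "card NC = 2 \<and> (\<forall>i\<in>NC. null_graph (commuting_graph (S i)))"
      using that by (intro null) simp_all
  qed
qed

end
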